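(* Suppose that the collection of past assortments is the collection of revenue-ordered assortments, i.e. $\{S_1,\dots,S_M\}=\bar{\mathcal{S}}$ where $\bar{\mathcal{S}}=\{\{0,m,m+1,\dots,n\}: m\in\{1,\dots,n\}\}$, and that $\eta=0$. Then $$\max_{S\in\mathcal{S}}\min_{\lambda\in\mathcal{U}}\mathscr{R}^\lambda(S)=\max_{m\in\mathcal{M}} r^\intercal v_m,\qquad\text{where } r^\intercal v_m=\sum_{i\in\mathcal{N}_0}r_iv_{m,i}.$$
   Context: Products: $\mathcal{N}=\{1,\dots,n\}$, and $0$ is the no-purchase option; $\mathcal{N}_0=\mathcal{N}\cup\{0\}$. Revenues satisfy $0=r_0<r_1<\cdots<r_n$. An assortment is a subset of $\mathcal{N}_0$, and $\mathcal{S}=\{S\subseteq\mathcal{N}_0: 0\in S\}$. Data: past assortments $S_1,\dots,S_M\subseteq\mathcal{N}_0$ with index set $\mathcal{M}=\{1,\dots,M\}$, and historical sales data $v_{m,i}\in[0,1]$ ($m\in\mathcal{M}$, $i\in\mathcal{N}_0$) with $\sum_{i\in\mathcal{N}_0}v_{m,i}=1$ for each $m$ and $v_{m,i}=0$ for $i\notin S_m$. Ranking-based choice models: $\Sigma$ is the set of all rankings, i.e. bijections $\sigma:\mathcal{N}_0\to\{0,\dots,n\}$. $\Delta_\Sigma$ is the set of probability distributions $\lambda=(\lambda_\sigma)_{\sigma\in\Sigma}$ on $\Sigma$. For $\lambda\in\Delta_\Sigma$ and an assortment $S$, $\mathscr{D}^\lambda_i(S)=\sum_{\sigma\in\Sigma}\mathbb{I}\{i=\arg\min_{j\in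 S}\sigma(j)\}\lambda_\sigma$ and $\mathscr{R}^\lambda(S)=\sum_{i\in\mathcal{N}_0}r_i\mathscr{D}^\lambda_i(S)$. Uncertainty set: for a radius $\eta\ge 0$ and $\|\cdot\|$ either the $\ell_1$- or $\ell_\infty$-norm, $\mathcal{U}$ is the set of $\lambda\in\Delta_\Sigma$ for which there is a vector $\epsilon=(\epsilon_{m,i})_{m\in\mathcal{M},i\in S_m}$ with $\|\epsilon\|\le\eta$ and $\mathscr{D}^\lambda_i(S_m)-v_{m,i}=\epsilon_{m,i}$ for all $m\in\mathcal{M}$, $i\in S_m$ (so for $\eta=0$ the model fits the data exactly). Standing assumption: $\mathcal{U}\neq\emptyset$. *)

theory Defs
  imports "HOL-Analysis.Analysis"
begin

text \<open>Options are \<open>{0..n}\<close>, where \<open>0\<close> is the no-purchase option.\<close>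

definition assortments :: "nat \<Rightarrow> nat set set" where
  "assortments n = {S. S \<subseteq> {0..n} \<and> 0 \<in> S}"

definition revenue_ordered_assortments :: "nat \<Rightarrow> nat set set" where
  "revenue_ordered_assortments n = (\<lambda>m. insert 0 {m..n}) ` {1..n}"

text \<open>Functions on an index set are represented extensionally, so that each ranking and each
  distribution has exactly one representative; in particular the set of rankings is finite
  and sums over it are genuine.\<close>

definition rankings :: "nat \<Rightarrow> (nat \<Rightarrow> nat) set" where
  "rankings n = {\<sigma> \<in> extensional {0..n}. bij_betw \<sigma> {0..n} {0..n}}"

definition ranking_distributions :: "nat \<Rightarrow> ((nat \<Rightarrow> nat) \<Rightarrow> real) set" where
  "ranking_distributions n =
     {\<mu> \<in> extensional (rankings n).
        (\<forall>\<sigma>\<in>rankings n. 0 \<le> \<mu> \<sigma>) \<and> (\<Sum>\<sigma>\<in>rankings n. \<mu> \<sigma>) = 1}"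

text \<open>The lowest rank value is the most preferred. The minimizer is unique for every nonempty
  \<open>S \<subseteq> {0..n}\<close>, since rankings are injective.\<close>

definition choice_prob :: "nat \<Rightarrow> ((nat \<Rightarrow> nat) \<Rightarrow> real) \<Rightarrow> nat set \<Rightarrow> nat \<Rightarrow> real" where
  "choice_prob n \<mu> S i = (\<Sum>\<sigma>\<in>rankings n. of_bool (i = arg_min_on \<sigma> S) * \<mu> \<sigma>)"

definition expected_revenue ::
  "nat \<Rightarrow> (nat \<Rightarrow> real) \<Rightarrow> ((nat \<Rightarrow> nat) \<Rightarrow> real) \<Rightarrow> nat set \<Rightarrow> real" where
  "expected_revenue n r \<mu> S = (\<Sum>i\<in>{0..n}. r i * choice_prob n \<mu> S i)"

text \<open>Norms of a real vector indexed by a finite set \<open>I\<close>; inserting \<open>0\<close> only matters for empty \<open>I\<close>.\<close>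

definition l1_norm :: "'a set \<Rightarrow> ('a \<Rightarrow> real) \<Rightarrow> real" where
  "l1_norm I x = (\<Sum>i\<in>I. \<bar>x i\<bar>)"

definition linf_norm :: "'a set \<Rightarrow> ('a \<Rightarrow> real) \<Rightarrow> real" where
  "linf_norm I x = Max (insert 0 ((\<lambda>i. \<bar>x i\<bar>) ` I))"

text \<open>\<open>A m\<close> for \<open>m \<in> {1..M}\<close> are the past assortments, \<open>v m i\<close> the historical sales data,
  \<open>nrm\<close> the norm and \<open>\<eta>\<close> the radius.\<close>

definition uncertainty_set ::
  "nat \<Rightarrow> nat \<Rightarrow> (nat \<Rightarrow> nat set) \<Rightarrow> (nat \<Rightarrow> nat \<Rightarrow> real)
    \<Rightarrow> ((nat \<times> nat) set \<Rightarrow> (nat \<times> nat \<Rightarrow> real) \<Rightarrow> real) \<Rightarrow> real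
    \<Rightarrow> ((nat \<Rightarrow> nat) \<Rightarrow> real) set" where
  "uncertainty_set n M A v nrm \<eta> =
     {\<mu> \<in> ranking_distributions n.
        \<exists>\<epsilon>. nrm (SIGMA m:{1..M}. A m) \<epsilon> \<le> \<eta> \<and>
            (\<forall>m\<in>{1..M}. \<forall>i\<in>A m. choice_prob n \<mu> (A m) i - v m i = \<epsilon> (m, i))}"

end

theory Submission
  imports Defs
begin

text \<open>
  Write \<open>A\<^sub>m = {0, m, ..., n}\<close> for the revenue-ordered assortments. For radius \<open>0\<close>, every model in the
  uncertainty set reproduces the sales of every \<open>A\<^sub>m\<close>, so the revenue of \<open>A\<^sub>m\<close> is \<open>r\<^sup>T v\<^sub>m\<close> whatever the
  model is. Offering the best past assortment therefore guarantees the right-hand side.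

  For the converse, \<open>S = {0}\<close> earns nothing. Let \<open>S\<close> be any assortment containing a product, and \<open>j\<close> its cheapest product. A
  customer type \<open>\<sigma>\<close> buys some \<open>k\<close> from \<open>A\<^sub>j\<close>, and \<open>S \<subseteq> A\<^sub>j\<close>. If \<open>k \<in> S\<close>, the same customer buys \<open>k\<close>
  from \<open>S\<close>. Otherwise \<open>k > j\<close>, and \<open>k\<close> is preferred to everything in \<open>S\<close>; then \<open>j\<close> can be moved
  to the position directly behind \<open>k\<close>. This goes unnoticed in the data, since every \<open>A\<^sub>m\<close> containing
  \<open>j\<close> contains \<open>k\<close> too, but now the customer buys \<open>j\<close> from \<open>S\<close>, which is cheaper than \<open>k\<close>
  (\<open>cautious_ranking\<close>). Performing this change on every customer type turns a model in the uncertainty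
  set into another one (\<open>pushforward\<close>), under which \<open>S\<close> earns at most what \<open>A\<^sub>j\<close> earns, namely
  \<open>r\<^sup>T v\<^sub>j\<close> (\<open>worst_case_le_revenue_ordered\<close>).

  The minima over the uncertainty set exist because that set is compact in the product topology.
\<close>

section \<open>Choices made by a ranking\<close>

lemma ranking_inj: "\<sigma> \<in> rankings n \<Longrightarrow> inj_on \<sigma> {0..n}"
  by (auto simp: rankings_def bij_betw_def)

lemma finite_rankings: "finite (rankings n)"
proof (rule finite_subset)
  show "rankings n \<subseteq> {0..n} \<rightarrow>\<^sub>E {0..n}"
    by (auto simp: rankings_def bij_betw_def PiE_def)
qed (simp add: finite_PiE)

lemma arg_min_on_mem_le:
  fixes \<sigma> :: "nat \<Rightarrow> nat"
  assumes "T \<subseteq> {0..n}" "T \<noteq> {}"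
  shows "arg_min_on \<sigma> T \<in> T" "\<And>y. y \<in> T \<Longrightarrow> \<sigma> (arg_min_on \<sigma> T) \<le> \<sigma> y"
proof -
  have "finite T" using assms(1) finite_subset by blast
  then show "arg_min_on \<sigma> T \<in> T" "\<And>y. y \<in> T \<Longrightarrow> \<sigma> (arg_min_on \<sigma> T) \<le> \<sigma> y"
    using arg_min_if_finite[of T \<sigma>] assms(2) by (auto simp: not_less)
qed

lemma arg_min_on_eqI:
  assumes "\<sigma> \<in> rankings n" "T \<subseteq> {0..n}" "x \<in> T" "\<And>y. y \<in> T \<Longrightarrow> \<sigma> x \<le> \<sigma> y"
  shows "arg_min_on \<sigma> T = x"
proof -
  have ne: "T \<noteq> {}" using assms(3) by blast
  note mem = arg_min_on_mem_le[OF assms(2) ne, where \<sigma> = \<sigma>]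
  have "\<sigma> (arg_min_on \<sigma> T) = \<sigma> x"
    using mem assms(3,4) by (simp add: le_antisym)
  then show ?thesis
    using inj_onD[OF ranking_inj[OF assms(1)]] mem(1) assms(2,3) by blast
qed

text \<open>Only the order of the scores matters, so a ranking may be described by convenient scores
  with gaps: counting the smaller scores closes the gaps.\<close>

lemma ranking_of_scores:
  fixes f :: "nat \<Rightarrow> nat"
  assumes inj: "inj_on f {0..n}"
  obtains \<tau> where "\<tau> \<in> rankings n"
    "\<And>x y. x \<in> {0..n} \<Longrightarrow> y \<in> {0..n} \<Longrightarrow> f x \<le> f y \<Longrightarrow> \<tau> x \<le> \<tau> y"
proof -
  define \<tau> where "\<tau> = restrict (\<lambda>x. card {y \<in> {0..n}. f y < f x}) {0..n}"
  have less: "\<tau> x < \<tau> y" if "x \<in> {0..n}" "y \<in> {0..n}" "f x < f y" for x y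
  proof -
    have "{z \<in> {0..n}. f z < f x} \<subset> {z \<in> {0..n}. f z < f y}"
      using that by auto
    then show ?thesis
      using that by (simp add: \<tau>_def psubset_card_mono)
  qed
  have "inj_on \<tau> {0..n}"
  proof (rule inj_onI)
    fix x y assume "x \<in> {0..n}" "y \<in> {0..n}" "\<tau> x = \<tau> y"
    then show "x = y"
      using less[of x y] less[of y x] inj_onD[OF inj, of x y] by force
  qed
  moreover have "\<tau> x \<in> {0..n}" if "x \<in> {0..n}" for x
  proof -
    have "{y \<in> {0..n}. f y < f x} \<subset> {0..n}"
      using that by blast
    then have "card {y \<in> {0..n}. f y < f x} < card {0..n}"
      by (intro psubset_card_mono) auto
    then show ?thesis
      using that by (simp add: \<tau>_def)
  qed
  ultimately have "bij_betw \<tau> {0..n} {0..n}"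
    unfolding bij_betw_def by (metis endo_inj_surj finite_atLeastAtMost image_subsetI)
  then have "\<tau> \<in> rankings n"
    by (simp add: rankings_def \<tau>_def)
  moreover have "\<tau> x \<le> \<tau> y" if "x \<in> {0..n}" "y \<in> {0..n}" "f x \<le> f y" for x y
    using less[OF that(1,2)] that inj_onD[OF inj, of x y] by (cases "f x = f y") auto
  ultimately show thesis
    by (rule that)
qed

text \<open>Moving \<open>i\<close> up to the position directly behind \<open>k\<close> can affect a choice only where \<open>i\<close> is offered
  without \<open>k\<close>.\<close>

lemma move_behind:
  assumes \<sigma>: "\<sigma> \<in> rankings n" and i: "i \<in> {0..n}" and k: "k \<in> {0..n}" and less: "\<sigma> k < \<sigma> i"
  obtains \<tau> where "\<tau> \<in> rankings n"
    "\<And>T. T \<subseteq> {0..n} \<Longrightarrow> T \<noteq> {} \<Longrightarrow> (i \<in> T \<longrightarrow> k \<in> T) \<Longrightarrow> arg_min_on \<tau> T = arg_min_on \<sigma> T"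
    "\<And>T. T \<subseteq> {0..n} \<Longrightarrow> i \<in> T \<Longrightarrow> (\<And>y. y \<in> T \<Longrightarrow> \<sigma> k < \<sigma> y) \<Longrightarrow> arg_min_on \<tau> T = i"
proof -
  \<comment> \<open>Doubling the ranks makes room for \<open>i\<close> directly behind \<open>k\<close>.\<close>
  define f where "f = (\<lambda>x. if x = i then 2 * \<sigma> k + 1 else 2 * \<sigma> x)"
  have odd_neq: "2 * a \<noteq> Suc (2 * b)" "Suc (2 * b) \<noteq> 2 * a" for a b :: nat
    by presburger+
  have "inj_on f {0..n}"
    using ranking_inj[OF \<sigma>] by (auto simp: inj_on_def f_def odd_neq)
  then obtain \<tau> where \<tau>: "\<tau> \<in> rankings n"
    and mono: "\<And>x y. x \<in> {0..n} \<Longrightarrow> y \<in> {0..n} \<Longrightarrow> f x \<le> f y \<Longrightarrow> \<tau> x \<le> \<tau> y"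
    using ranking_of_scores by blast
  show thesis
  proof (rule that[OF \<tau>])
    fix T assume T: "T \<subseteq> {0..n}" "T \<noteq> {}" "i \<in> T \<longrightarrow> k \<in> T"
    let ?c = "arg_min_on \<sigma> T"
    note c = arg_min_on_mem_le[OF T(1,2), where \<sigma> = \<sigma>]
    have "?c \<noteq> i"
      using c T(3) less by (metis not_less)
    moreover have "\<sigma> ?c \<le> \<sigma> k" if "i \<in> T"
      using that c T(3) by blast
    ultimately have "f ?c \<le> f y" if "y \<in> T" for y
      using c(2)[OF that] that by (auto simp: f_def)
    then show "arg_min_on \<tau> T = ?c"
      by (intro arg_min_on_eqI[OF \<tau> T(1)] mono) (use c T(1) in auto)
  next
    fix T assume T: "T \<subseteq> {0..n}" "i \<in> T" "\<And>y. y \<in> T \<Longrightarrow> \<sigma> k < \<sigma> y"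
    have "f i \<le> f y" if "y \<in> T" for y
      using T(3)[OF that] by (simp add: f_def)
    then show "arg_min_on \<tau> T = i"
      by (intro arg_min_on_eqI[OF \<tau> T(1)] mono) (use T(1,2) in auto)
  qed
qed

text \<open>Revenue-ordered data cannot tell \<open>\<sigma>\<close> from \<open>\<tau>\<close>. The choice \<open>k\<close> of \<open>\<sigma>\<close> from the hull
  \<open>{0, j, ..., n}\<close> precedes all other options in \<open>S\<close>; so if \<open>k\<close> is missing from \<open>S\<close>, putting \<open>j\<close>
  directly behind \<open>k\<close> makes \<open>j < k\<close> the choice from \<open>S\<close>. It is here that the assortments being
  revenue-ordered matters: whichever of them contains \<open>j\<close> also contains the more expensive \<open>k\<close>.\<close>

lemma cautious_ranking:
  assumes \<sigma>: "\<sigma> \<in> rankings n" and S: "S \<subseteq> insert 0 {j..n}" and "0 \<in> S" "0 < j" "j \<in> S" "j \<le> n"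
  obtains \<tau> where "\<tau> \<in> rankings n"
    "\<And>m. arg_min_on \<tau> (insert 0 {m..n}) = arg_min_on \<sigma> (insert 0 {m..n})"
    "arg_min_on \<tau> S \<le> arg_min_on \<sigma> (insert 0 {j..n})"
proof -
  have hull: "insert 0 {m..n} \<subseteq> {0..n}" "insert 0 {m..n} \<noteq> {}" for m
    by auto
  have Sn: "S \<subseteq> {0..n}" using S hull by blast
  define k where "k = arg_min_on \<sigma> (insert 0 {j..n})"
  have k: "k \<in> insert 0 {j..n}" "\<And>y. y \<in> S \<Longrightarrow> \<sigma> k \<le> \<sigma> y"
    unfolding k_def using arg_min_on_mem_le[OF hull, where \<sigma> = \<sigma>] S by blast+
  then have kn: "k \<in> {0..n}" using hull by blast
  show thesis
  proof (cases "k \<in> S")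
    case True
    then have "arg_min_on \<sigma> S = k"
      by (intro arg_min_on_eqI[OF \<sigma> Sn] k)
    then show ?thesis
      using that[OF \<sigma>] by (simp add: k_def)
  next
    case False
    have strict: "\<sigma> k < \<sigma> y" if "y \<in> S" for y
    proof -
      have "\<sigma> k \<noteq> \<sigma> y"
        using inj_onD[OF ranking_inj[OF \<sigma>], of k y] that kn Sn False by blast
      then show ?thesis using k(2)[OF that] by simp
    qed
    have "k \<noteq> 0" "k \<noteq> j"
      using False \<open>0 \<in> S\<close> \<open>j \<in> S\<close> by metis+
    then have jk: "j < k" "k \<le> n"
      using k(1) by auto
    have jn: "j \<in> {0..n}" using \<open>j \<le> n\<close> by simp
    obtain \<tau> where \<tau>: "\<tau> \<in> rankings n"
      and same: "\<And>T. T \<subseteq> {0..n} \<Longrightarrow> T \<noteq> {} \<Longrightarrow> (j \<in> T \<longrightarrow> k \<in> T) \<Longrightarrow>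
        arg_min_on \<tau> T = arg_min_on \<sigma> T"
      and behind: "\<And>T. T \<subseteq> {0..n} \<Longrightarrow> j \<in> T \<Longrightarrow> (\<And>y. y \<in> T \<Longrightarrow> \<sigma> k < \<sigma> y) \<Longrightarrow>
        arg_min_on \<tau> T = j"
      using move_behind[OF \<sigma> jn kn strict[OF \<open>j \<in> S\<close>]] by blast
    show ?thesis
    proof (rule that[OF \<tau>])
      show "arg_min_on \<tau> (insert 0 {m..n}) = arg_min_on \<sigma> (insert 0 {m..n})" for m
        by (intro same hull) (use jk \<open>0 < j\<close> in auto)
      have "arg_min_on \<tau> S = j"
        using behind[OF Sn \<open>j \<in> S\<close> strict] .
      then show "arg_min_on \<tau> S \<le> arg_min_on \<sigma> (insert 0 {j..n})"
        using jk by (simp add: k_def)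
    qed
  qed
qed

section \<open>Ranking-based choice models\<close>

lemma expected_revenue_alt:
  assumes "S \<subseteq> {0..n}" "S \<noteq> {}"
  shows "expected_revenue n r \<mu> S = (\<Sum>\<sigma>\<in>rankings n. r (arg_min_on \<sigma> S) * \<mu> \<sigma>)"
proof -
  have "expected_revenue n r \<mu> S =
      (\<Sum>\<sigma>\<in>rankings n. \<Sum>i\<in>{0..n}. r i * (of_bool (i = arg_min_on \<sigma> S) * \<mu> \<sigma>))"
    unfolding expected_revenue_def choice_prob_def sum_distrib_left by (rule sum.swap)
  also have "\<dots> = (\<Sum>\<sigma>\<in>rankings n. r (arg_min_on \<sigma> S) * \<mu> \<sigma>)"
  proof (rule sum.cong[OF refl])
    fix \<sigma> :: "nat \<Rightarrow> nat"
    have "arg_min_on \<sigma> S \<in> {0..n}"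
      using arg_min_on_mem_le(1)[OF assms, where \<sigma> = \<sigma>] assms(1) by blast
    moreover have "(\<Sum>i\<in>{0..n}. r i * (of_bool (i = arg_min_on \<sigma> S) * \<mu> \<sigma>)) =
        (\<Sum>i\<in>{0..n}. if i = arg_min_on \<sigma> S then r i * \<mu> \<sigma> else 0)"
      by (intro sum.cong) auto
    ultimately show "(\<Sum>i\<in>{0..n}. r i * (of_bool (i = arg_min_on \<sigma> S) * \<mu> \<sigma>)) =
        r (arg_min_on \<sigma> S) * \<mu> \<sigma>"
      by simp
  qed
  finally show ?thesis .
qed

lemma choice_prob_not_offered:
  assumes "S \<subseteq> {0..n}" "S \<noteq> {}" "i \<notin> S"
  shows "choice_prob n \<mu> S i = 0"
  unfolding choice_prob_def
  using arg_min_on_mem_le(1)[OF assms(1,2)] assms(3) by (intro sum.neutral) auto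

definition pushforward ::
  "nat \<Rightarrow> ((nat \<Rightarrow> nat) \<Rightarrow> nat \<Rightarrow> nat) \<Rightarrow> ((nat \<Rightarrow> nat) \<Rightarrow> real) \<Rightarrow> (nat \<Rightarrow> nat) \<Rightarrow> real" where
  "pushforward n t \<mu> = (\<lambda>\<tau>\<in>rankings n. \<Sum>\<sigma>\<in>{\<sigma> \<in> rankings n. t \<sigma> = \<tau>}. \<mu> \<sigma>)"

lemma sum_pushforward:
  fixes g :: "(nat \<Rightarrow> nat) \<Rightarrow> real"
  assumes "t ` rankings n \<subseteq> rankings n"
  shows "(\<Sum>\<tau>\<in>rankings n. g \<tau> * pushforward n t \<mu> \<tau>) = (\<Sum>\<sigma>\<in>rankings n. g (t \<sigma>) * \<mu> \<sigma>)"
proof -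
  have "(\<Sum>\<tau>\<in>rankings n. g \<tau> * pushforward n t \<mu> \<tau>) =
      (\<Sum>\<tau>\<in>rankings n. \<Sum>\<sigma>\<in>{\<sigma> \<in> rankings n. t \<sigma> = \<tau>}. g (t \<sigma>) * \<mu> \<sigma>)"
    by (intro sum.cong) (auto simp: pushforward_def sum_distrib_left)
  also have "\<dots> = (\<Sum>\<sigma>\<in>rankings n. g (t \<sigma>) * \<mu> \<sigma>)"
    by (rule sum.group[OF finite_rankings finite_rankings assms])
  finally show ?thesis .
qed

lemma pushforward_distribution:
  assumes "t ` rankings n \<subseteq> rankings n" "\<mu> \<in> ranking_distributions n"
  shows "pushforward n t \<mu> \<in> ranking_distributions n"
  using assms sum_pushforward[OF assms(1), of "\<lambda>_. 1" \<mu>]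
  by (auto simp: ranking_distributions_def pushforward_def intro: sum_nonneg)

section \<open>Models that fit the data exactly\<close>

definition exact_fits ::
  "nat \<Rightarrow> nat \<Rightarrow> (nat \<Rightarrow> nat set) \<Rightarrow> (nat \<Rightarrow> nat \<Rightarrow> real) \<Rightarrow> ((nat \<Rightarrow> nat) \<Rightarrow> real) set" where
  "exact_fits n M A v =
     {\<mu> \<in> ranking_distributions n. \<forall>m\<in>{1..M}. \<forall>i\<in>A m. choice_prob n \<mu> (A m) i = v m i}"

lemma norm_le_zero:
  assumes "nrm \<in> {l1_norm, linf_norm}" "finite I" "nrm I x \<le> 0" "i \<in> I"
  shows "x i = 0"
proof (cases "nrm = l1_norm")
  case True
  then have "(\<Sum>i\<in>I. \<bar>x i\<bar>) = 0"
    using assms(3) by (intro antisym sum_nonneg) (auto simp: l1_norm_def)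
  then show ?thesis
    using assms(2,4) by (simp add: sum_nonneg_eq_0_iff)
next
  case False
  then have "Max (insert 0 ((\<lambda>i. \<bar>x i\<bar>) ` I)) \<le> 0"
    using assms(1,3) by (simp add: linf_norm_def)
  moreover have "\<bar>x i\<bar> \<le> Max (insert 0 ((\<lambda>i. \<bar>x i\<bar>) ` I))"
    using assms(2,4) by (intro Max_ge) auto
  ultimately show ?thesis by simp
qed

lemma norm_zero:
  assumes "nrm \<in> {l1_norm, linf_norm}"
  shows "nrm I (\<lambda>_. 0) = 0"
proof -
  have "insert 0 ((\<lambda>_. 0::real) ` I) = {0}" by auto
  then have "linf_norm I (\<lambda>_. 0) = 0"
    unfolding linf_norm_def abs_zero by (metis Max_singleton)
  then show ?thesis using assms by (auto simp: l1_norm_def)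
qed

lemma uncertainty_set_zero:
  assumes nrm: "nrm \<in> {l1_norm, linf_norm}"
    and A: "\<And>m. m \<in> {1..M} \<Longrightarrow> A m \<subseteq> {0..n}"
  shows "uncertainty_set n M A v nrm 0 = exact_fits n M A v"
proof (intro set_eqI iffI)
  fix \<mu> assume "\<mu> \<in> uncertainty_set n M A v nrm 0"
  then obtain \<epsilon> where \<mu>: "\<mu> \<in> ranking_distributions n"
    and \<epsilon>: "nrm (SIGMA m:{1..M}. A m) \<epsilon> \<le> 0"
      "\<And>m i. m \<in> {1..M} \<Longrightarrow> i \<in> A m \<Longrightarrow> choice_prob n \<mu> (A m) i - v m i = \<epsilon> (m, i)"
    by (auto simp: uncertainty_set_def)
  have "finite (SIGMA m:{1..M}. A m)"
    using A by (intro finite_SigmaI) (auto intro: finite_subset)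
  then have "\<epsilon> (m, i) = 0" if "m \<in> {1..M}" "i \<in> A m" for m i
    using that norm_le_zero[OF nrm _ \<epsilon>(1)] by blast
  then show "\<mu> \<in> exact_fits n M A v"
    using \<mu> \<epsilon>(2) by (auto simp: exact_fits_def)
next
  fix \<mu> assume "\<mu> \<in> exact_fits n M A v"
  then show "\<mu> \<in> uncertainty_set n M A v nrm 0"
    using norm_zero[OF nrm]
    by (auto simp: exact_fits_def uncertainty_set_def intro!: exI[of _ "\<lambda>_. 0"])
qed

lemma continuous_on_choice_prob: "continuous_on X (\<lambda>\<mu>. choice_prob n \<mu> S i)"
  unfolding choice_prob_def
  by (intro continuous_intros continuous_on_subset[OF continuous_on_product_coordinates]) auto

lemma continuous_on_expected_revenue: "continuous_on X (\<lambda>\<mu>. expected_revenue n r \<mu> S)"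
  unfolding expected_revenue_def by (intro continuous_intros continuous_on_choice_prob)

text \<open>A distribution takes values in \<open>[0, 1]\<close> on rankings and the single value \<open>undefined\<close> elsewhere,
  so Tychonoff's theorem applies.\<close>

lemma compact_ranking_distributions: "compact (ranking_distributions n)"
proof -
  define B where "B = (\<lambda>\<sigma>. if \<sigma> \<in> rankings n then {0..1} else {undefined::real})"
  have "compactin (product_topology (\<lambda>_. euclidean) UNIV) (PiE UNIV B)"
    unfolding compactin_PiE by (auto simp: B_def)
  then have "compact (PiE UNIV B)"
    by (simp add: euclidean_product_topology)
  moreover have "closed {\<mu> :: (nat \<Rightarrow> nat) \<Rightarrow> real. (\<Sum>\<sigma>\<in>rankings n. \<mu> \<sigma>) = 1}"
    by (intro closed_Collect_eq continuous_intros continuous_on_product_coordinates)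
  moreover have "ranking_distributions n =
      PiE UNIV B \<inter> {\<mu> :: (nat \<Rightarrow> nat) \<Rightarrow> real. (\<Sum>\<sigma>\<in>rankings n. \<mu> \<sigma>) = 1}"
  proof (intro set_eqI iffI)
    fix \<mu> assume "\<mu> \<in> ranking_distributions n"
    then have \<mu>: "\<mu> \<in> extensional (rankings n)" "\<And>\<sigma>. \<sigma> \<in> rankings n \<Longrightarrow> 0 \<le> \<mu> \<sigma>"
      "(\<Sum>\<sigma>\<in>rankings n. \<mu> \<sigma>) = 1"
      by (auto simp: ranking_distributions_def)
    then have "\<mu> \<sigma> \<le> 1" if "\<sigma> \<in> rankings n" for \<sigma>
      using member_le_sum[OF that, of \<mu>] finite_rankings by auto
    then show "\<mu> \<in> PiE UNIV B \<inter> {\<mu>. (\<Sum>\<sigma>\<in>rankings n. \<mu> \<sigma>) = 1}"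
      using \<mu> by (auto simp: B_def extensional_def)
  next
    fix \<mu> assume "\<mu> \<in> PiE UNIV B \<inter> {\<mu>. (\<Sum>\<sigma>\<in>rankings n. \<mu> \<sigma>) = 1}"
    then have B: "\<And>\<sigma>. \<mu> \<sigma> \<in> B \<sigma>" and "(\<Sum>\<sigma>\<in>rankings n. \<mu> \<sigma>) = 1"
      by auto
    moreover have "0 \<le> \<mu> \<sigma>" if "\<sigma> \<in> rankings n" for \<sigma>
      using B[of \<sigma>] that by (simp add: B_def)
    moreover have "\<mu> \<sigma> = undefined" if "\<sigma> \<notin> rankings n" for \<sigma>
      using B[of \<sigma>] that by (simp add: B_def)
    ultimately show "\<mu> \<in> ranking_distributions n"
      by (simp add: ranking_distributions_def extensional_def)
  qed
  ultimately show ?thesis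
    by (simp add: compact_Int_closed)
qed

lemma compact_exact_fits: "compact (exact_fits n M A v)"
proof -
  have "exact_fits n M A v = ranking_distributions n \<inter>
      (\<Inter>m\<in>{1..M}. \<Inter>i\<in>A m. {\<mu>. choice_prob n \<mu> (A m) i = v m i})"
    by (auto simp: exact_fits_def)
  moreover have "closed (\<Inter>m\<in>{1..M}. \<Inter>i\<in>A m. {\<mu>. choice_prob n \<mu> (A m) i = v m i})"
    by (intro closed_INT ballI closed_Collect_eq continuous_on_choice_prob continuous_on_const)
  ultimately show ?thesis
    using compact_ranking_distributions by (simp add: compact_Int_closed)
qed

lemma worst_case_attained:
  assumes "exact_fits n M A v \<noteq> {}"
  shows "\<exists>\<mu>\<in>exact_fits n M A v. \<forall>\<mu>'\<in>exact_fits n M A v.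
    expected_revenue n r \<mu> S \<le> expected_revenue n r \<mu>' S"
  by (rule continuous_attains_inf[OF compact_exact_fits assms continuous_on_expected_revenue])

lemma revenue_of_past_assortment:
  assumes "\<mu> \<in> exact_fits n M A v" "m \<in> {1..M}" "A m \<subseteq> {0..n}" "A m \<noteq> {}"
    and "\<And>i. i \<in> {0..n} \<Longrightarrow> i \<notin> A m \<Longrightarrow> v m i = 0"
  shows "expected_revenue n r \<mu> (A m) = (\<Sum>i\<in>{0..n}. r i * v m i)"
  unfolding expected_revenue_def
proof (rule sum.cong[OF refl])
  fix i assume "i \<in> {0..n}"
  then have "choice_prob n \<mu> (A m) i = v m i"
    using assms choice_prob_not_offered[OF assms(3,4)]
    by (cases "i \<in> A m") (auto simp: exact_fits_def)
  then show "r i * choice_prob n \<mu> (A m) i = r i * v m i" by simp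
qed

section \<open>Revenue-ordered data\<close>

text \<open>The customer-by-customer change of \<open>cautious_ranking\<close> leaves all sales data intact, hence stays
  within the models that fit exactly.\<close>

lemma worst_case_le_revenue_ordered:
  assumes r: "mono_on {0..n} r"
    and past: "\<And>m. m \<in> {1..M} \<Longrightarrow> \<exists>l. A m = insert 0 {l..n}"
    and \<mu>: "\<mu> \<in> exact_fits n M A v"
    and S: "S \<subseteq> insert 0 {j..n}" "0 \<in> S" "0 < j" "j \<in> S" "j \<le> n"
  obtains \<mu>' where "\<mu>' \<in> exact_fits n M A v"
    "expected_revenue n r \<mu>' S \<le> expected_revenue n r \<mu> (insert 0 {j..n})"
proof -
  have "\<forall>\<sigma>\<in>rankings n. \<exists>\<tau>. \<tau> \<in> rankings n \<and>
      (\<forall>m. arg_min_on \<tau> (insert 0 {m..n}) = arg_min_on \<sigma> (insert 0 {m..n})) \<and>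
      arg_min_on \<tau> S \<le> arg_min_on \<sigma> (insert 0 {j..n})"
  proof
    fix \<sigma> assume "\<sigma> \<in> rankings n"
    from cautious_ranking[OF this S] show "\<exists>\<tau>. \<tau> \<in> rankings n \<and>
        (\<forall>m. arg_min_on \<tau> (insert 0 {m..n}) = arg_min_on \<sigma> (insert 0 {m..n})) \<and>
        arg_min_on \<tau> S \<le> arg_min_on \<sigma> (insert 0 {j..n})"
      by blast
  qed
  from bchoice[OF this] obtain t where t: "\<And>\<sigma>. \<sigma> \<in> rankings n \<Longrightarrow> t \<sigma> \<in> rankings n"
    and data: "\<And>\<sigma> m. \<sigma> \<in> rankings n \<Longrightarrow>
      arg_min_on (t \<sigma>) (insert 0 {m..n}) = arg_min_on \<sigma> (insert 0 {m..n})"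
    and cheaper: "\<And>\<sigma>. \<sigma> \<in> rankings n \<Longrightarrow> arg_min_on (t \<sigma>) S \<le> arg_min_on \<sigma> (insert 0 {j..n})"
    by blast
  have t': "t ` rankings n \<subseteq> rankings n" using t by blast
  have dist: "\<mu> \<in> ranking_distributions n"
    using \<mu> by (simp add: exact_fits_def)
  have hull: "insert 0 {m..n} \<subseteq> {0..n}" "insert 0 {m..n} \<noteq> {}" for m
    by auto
  have Sn: "S \<subseteq> {0..n}" "S \<noteq> {}" using S hull by auto
  have same: "choice_prob n (pushforward n t \<mu>) (insert 0 {m..n}) i =
      choice_prob n \<mu> (insert 0 {m..n}) i" for m i
    unfolding choice_prob_def sum_pushforward[OF t'] by (simp add: data)
  have "choice_prob n (pushforward n t \<mu>) (A m) i = v m i" if m: "m \<in> {1..M}" and "i \<in> A m" for m i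
  proof -
    have "choice_prob n \<mu> (A m) i = v m i"
      using \<mu> that by (simp add: exact_fits_def)
    moreover obtain l where "A m = insert 0 {l..n}"
      using past[OF m] by blast
    ultimately show ?thesis using same by simp
  qed
  then have "pushforward n t \<mu> \<in> exact_fits n M A v"
    using pushforward_distribution[OF t' dist] by (simp add: exact_fits_def)
  moreover have "expected_revenue n r (pushforward n t \<mu>) S \<le>
      expected_revenue n r \<mu> (insert 0 {j..n})"
    unfolding expected_revenue_alt[OF Sn] expected_revenue_alt[OF hull] sum_pushforward[OF t']
  proof (intro sum_mono mult_right_mono)
    fix \<sigma> assume \<sigma>: "\<sigma> \<in> rankings n"
    show "0 \<le> \<mu> \<sigma>" using dist \<sigma> by (simp add: ranking_distributions_def)
    have "arg_min_on (t \<sigma>) S \<in> {0..n}" "arg_min_on \<sigma> (insert 0 {j..n}) \<in> {0..n}"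
      using arg_min_on_mem_le(1)[OF Sn] arg_min_on_mem_le(1)[OF hull] Sn hull by blast+
    then show "r (arg_min_on (t \<sigma>) S) \<le> r (arg_min_on \<sigma> (insert 0 {j..n}))"
      by (rule mono_onD[OF r _ _ cheaper[OF \<sigma>]])
  qed
  ultimately show thesis by (rule that)
qed

theorem corollary1:
  fixes n M :: nat
    and r :: "nat \<Rightarrow> real"
    and A :: "nat \<Rightarrow> nat set"
    and v :: "nat \<Rightarrow> nat \<Rightarrow> real"
    and nrm :: "(nat \<times> nat) set \<Rightarrow> (nat \<times> nat \<Rightarrow> real) \<Rightarrow> real"
    and \<eta> :: real
    and U :: "((nat \<Rightarrow> nat) \<Rightarrow> real) set"
  assumes n_pos: "1 \<le> n"
    and r_zero: "r 0 = 0"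
    and r_mono: "strict_mono_on {0..n} r"
    and A_sub: "\<And>m. m \<in> {1..M} \<Longrightarrow> A m \<subseteq> {0..n}"
    and v_range: "\<And>m i. m \<in> {1..M} \<Longrightarrow> i \<in> {0..n} \<Longrightarrow> v m i \<in> {0..1}"
    and v_sum: "\<And>m. m \<in> {1..M} \<Longrightarrow> (\<Sum>i\<in>{0..n}. v m i) = 1"
    and v_supp: "\<And>m i. m \<in> {1..M} \<Longrightarrow> i \<in> {0..n} \<Longrightarrow> i \<notin> A m \<Longrightarrow> v m i = 0"
    and nrm: "nrm \<in> {l1_norm, linf_norm}"
    and U_def: "U = uncertainty_set n M A v nrm \<eta>"
    and U_nonempty: "U \<noteq> {}"
    and A_revenue_ordered: "A ` {1..M} = revenue_ordered_assortments n"
    and eta_zero: "\<eta> = 0"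
  shows "(\<forall>S\<in>assortments n. \<exists>\<mu>\<in>U. \<forall>\<mu>'\<in>U. expected_revenue n r \<mu> S \<le> expected_revenue n r \<mu>' S) \<and>
    (MAX S\<in>assortments n. INF \<mu>\<in>U. expected_revenue n r \<mu> S) =
      (MAX m\<in>{1..M}. \<Sum>i\<in>{0..n}. r i * v m i)"
proof -
  define F where "F = exact_fits n M A v"
  have UF: "U = F"
    using uncertainty_set_zero[OF nrm A_sub] by (simp add: U_def eta_zero F_def)
  have Fne: "F \<noteq> {}" using U_nonempty UF by simp
  define w where "w = (\<lambda>S. INF \<mu>\<in>F. expected_revenue n r \<mu> S)"
  define b where "b = (\<lambda>m. \<Sum>i\<in>{0..n}. r i * v m i)"
  have attained: "\<exists>\<mu>\<in>F. \<forall>\<mu>'\<in>F. expected_revenue n r \<mu> S \<le> expected_revenue n r \<mu>' S" for S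
    using Fne unfolding F_def by (rule worst_case_attained)
  have w_le: "w S \<le> expected_revenue n r \<mu> S" if "\<mu> \<in> F" for S \<mu>
  proof -
    obtain \<mu>\<^sub>0 where "\<And>\<mu>'. \<mu>' \<in> F \<Longrightarrow> expected_revenue n r \<mu>\<^sub>0 S \<le> expected_revenue n r \<mu>' S"
      using attained by blast
    then show ?thesis
      unfolding w_def by (intro cINF_lower[OF bdd_belowI2 that])
  qed
  have past: "\<exists>l. A m = insert 0 {l..n}" if "m \<in> {1..M}" for m
    using imageI[OF that, of A] A_revenue_ordered by (auto simp: revenue_ordered_assortments_def)
  have revenue: "expected_revenue n r \<mu> (A m) = b m" if "\<mu> \<in> F" "m \<in> {1..M}" for \<mu> m
    unfolding b_def
  proof (rule revenue_of_past_assortment)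
    show "A m \<noteq> {}" using past[OF that(2)] by blast
    show "\<mu> \<in> exact_fits n M A v" using that(1) by (simp add: F_def)
  qed (use that(2) A_sub v_supp in blast)+
  have w_past: "w (A m) = b m" if "m \<in> {1..M}" for m
    unfolding w_def using revenue[OF _ that] Fne by simp
  have past_assortment: "A m \<in> assortments n" if "m \<in> {1..M}" for m
    using past[OF that] A_sub[OF that] by (simp add: assortments_def) blast
  have ordered_past: "\<exists>m\<in>{1..M}. A m = insert 0 {j..n}" if "j \<in> {1..n}" for j
  proof -
    have "insert 0 {j..n} \<in> A ` {1..M}"
      unfolding A_revenue_ordered revenue_ordered_assortments_def using that by (rule imageI)
    then show ?thesis by fastforce
  qed
  have fin: "finite (assortments n)"
    by (rule finite_subset[of _ "Pow {0..n}"]) (auto simp: assortments_def)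
  have one: "(1::nat) \<in> {1..n}" using n_pos by simp
  have r_mono': "mono_on {0..n} r"
    using r_mono by (rule strict_mono_on_imp_mono_on)
  have dominated: "\<exists>m\<in>{1..M}. w S \<le> b m" if S: "S \<in> assortments n" for S
  proof (cases "S = {0}")
    case True
    obtain \<mu> where \<mu>: "\<mu> \<in> F" using Fne by blast
    obtain m where m: "m \<in> {1..M}" using ordered_past[OF one] by blast
    have "expected_revenue n r \<mu> {0} = 0"
    proof -
      have "arg_min_on \<sigma> {0} = (0::nat)" for \<sigma> :: "nat \<Rightarrow> nat"
        using arg_min_on_mem_le(1)[of "{0}" n \<sigma>] by simp
      then show ?thesis
        by (simp add: expected_revenue_alt r_zero)
    qed
    moreover have "0 \<le> b m"
      unfolding b_def
    proof (intro sum_nonneg mult_nonneg_nonneg)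
      fix i assume i: "i \<in> {0..n}"
      show "0 \<le> r i" using mono_onD[OF r_mono', of 0 i] i r_zero by simp
      show "0 \<le> v m i" using v_range[OF m i] by simp
    qed
    ultimately have "w S \<le> b m"
      using w_le[OF \<mu>, of S] True by simp
    then show ?thesis using m by blast
  next
    case False
    have S': "S \<subseteq> {0..n}" "0 \<in> S" using S by (auto simp: assortments_def)
    define j where "j = Min (S - {0})"
    have fS: "finite (S - {0})" "S - {0} \<noteq> {}"
      using S' False finite_subset[OF S'(1)] by auto
    have j: "j \<in> S - {0}" "\<And>x. x \<in> S - {0} \<Longrightarrow> j \<le> x"
      unfolding j_def using Min_in[OF fS] Min_le[OF fS(1)] by blast+
    then have j1: "j \<in> {1..n}" "0 < j" "j \<in> S" "j \<le> n" using S' by auto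
    have hull: "S \<subseteq> insert 0 {j..n}"
    proof
      fix x assume "x \<in> S"
      then show "x \<in> insert 0 {j..n}" using j(2)[of x] S'(1) by (cases "x = 0") auto
    qed
    obtain m where m: "m \<in> {1..M}" "A m = insert 0 {j..n}"
      using ordered_past[OF j1(1)] by blast
    obtain \<mu> where \<mu>: "\<mu> \<in> F" using Fne by blast
    obtain \<mu>' where "\<mu>' \<in> F"
      "expected_revenue n r \<mu>' S \<le> expected_revenue n r \<mu> (insert 0 {j..n})"
      unfolding F_def
      by (rule worst_case_le_revenue_ordered[OF r_mono' past \<mu>[unfolded F_def] hull S'(2) j1(2-4)])
    then have "w S \<le> b m"
      using w_le[of \<mu>' S] revenue[OF \<mu> m(1)] m(2) by simp
    then show ?thesis using m(1) by blast
  qed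
  have "Max (w ` assortments n) = Max (b ` {1..M})"
  proof (rule antisym)
    have "{0} \<in> assortments n" by (simp add: assortments_def)
    then have "assortments n \<noteq> {}" by blast
    then show "Max (w ` assortments n) \<le> Max (b ` {1..M})"
    proof (intro Max.boundedI)
      fix x assume "x \<in> w ` assortments n"
      then obtain m where m: "m \<in> {1..M}" "x \<le> b m" using dominated by blast
      have "b m \<le> Max (b ` {1..M})"
        using m(1) by (intro Max_ge imageI) auto
      then show "x \<le> Max (b ` {1..M})" using m(2) by simp
    qed (use fin in auto)
    obtain m\<^sub>1 where "m\<^sub>1 \<in> {1..M}" using ordered_past[OF one] ..
    then have "{1..M} \<noteq> {}" by blast
    then show "Max (b ` {1..M}) \<le> Max (w ` assortments n)"
    proof (intro Max.boundedI)
      fix x assume "x \<in> b ` {1..M}"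
      then obtain m where m: "m \<in> {1..M}" "x = b m" by blast
      have "w (A m) \<le> Max (w ` assortments n)"
        using fin past_assortment[OF m(1)] by (intro Max_ge imageI finite_imageI)
      then show "x \<le> Max (w ` assortments n)" using w_past[OF m(1)] m(2) by simp
    qed simp_all
  qed
  then show ?thesis
    unfolding UF w_def b_def by (intro conjI ballI attained)
qed

end
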